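(* Let $T$ be any tree of order $n\ge 2$ and let $k$ be a positive integer. Then $\gamma_L^k(T)=n-ex(T)$ if and only if $k=1$, $ex(T)\ge 1$, and $ex(T)+\sigma(T)=n$.
   Context: All graphs are finite, simple, undirected and connected. $d(x,y)$ is the length of a shortest path between $x$ and $y$ in a graph $G$. For a positive integer $k$, let $d_k(x,y)=\min\{d(x,y),k+1\}$. A set $D\subseteq V(G)$ is a distance-$k$ dominating set of $G$ if for each $u\in V(G)\setminus D$ there is $w\in D$ with $d(u,w)\le k$. A set $S\subseteq V(G)$ is a distance-$k$ resolving set of $G$ if for any distinct $x,y\in V(G)$ there is $z\in S$ with $d_k(x,z)\ne d_k(y,z)$. A distance-$k$ locating-dominating set of $G$ is a set $S\subseteq V(G)$ that is both a distance-$k$ dominating set and a distance-$k$ resolving set of $G$; the distance-$k$ location-domination number $\gamma_L^k(G)$ is the minimum cardinality of such a set. A major vertex is a vertex of degree at least three; a leaf is a vertex of degree one. A leaf $\ell$ is a terminal vertex of a major vertex $v$ if $d(\ell,v)<d(\ell,w)$ for every other major vertex $w$. The terminal degree of a major vertex $v$ is the number of terminal vertices of $v$. An exterior major vertex is a major vertex of positive terminal degree; $ex(G)$ is the number of exterior major vertices of $G$, and $\sigma(G)$ is the number of leaves of $G$. *)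

theory Defs
  imports "Graph_Theory.Digraph_Component"
begin

text \<open>
  A finite simple undirected graph is a \<^locale>\<open>pair_graph\<close>: a finite, symmetric, loop-free
  digraph without parallel arcs, so that an edge \<open>{u, v}\<close> is the pair of arcs \<open>(u, v)\<close>, \<open>(v, u)\<close>.
  \<^term>\<open>with_proj\<close> views it as a general digraph, which is where walks, paths and degrees live.

  The library constant \<^const>\<open>tree\<close> is of no use for such graphs: as soon as there is an edge,
  \<open>u, v, u\<close> is a \<^const>\<open>pre_digraph.cycle\<close> of length two. The cycles of the undirected graph are
  the directed cycles of length at least three.
\<close>

definition undirected_tree :: "'a pair_pre_digraph \<Rightarrow> bool" where
  "undirected_tree G \<longleftrightarrow>
     pair_graph G \<and> Digraph_Component.connected (with_proj G) \<and>
     \<not> (\<exists>p. pre_digraph.cycle (with_proj G) p \<and> 3 \<le> length p)"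

text \<open>Only meaningful if \<open>y\<close> is reachable from \<open>x\<close>; otherwise the value is unspecified.\<close>

definition graph_dist :: "'a pair_pre_digraph \<Rightarrow> 'a \<Rightarrow> 'a \<Rightarrow> nat" where
  "graph_dist G x y = (LEAST m. \<exists>p. pre_digraph.apath (with_proj G) x p y \<and> length p = m)"

definition trunc_dist :: "'a pair_pre_digraph \<Rightarrow> nat \<Rightarrow> 'a \<Rightarrow> 'a \<Rightarrow> nat" where
  "trunc_dist G k x y = min (graph_dist G x y) (k + 1)"

definition dist_dominating :: "'a pair_pre_digraph \<Rightarrow> nat \<Rightarrow> 'a set \<Rightarrow> bool" where
  "dist_dominating G k D \<longleftrightarrow>
     D \<subseteq> pverts G \<and> (\<forall>u \<in> pverts G - D. \<exists>w \<in> D. graph_dist G u w \<le> k)"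

definition dist_resolving :: "'a pair_pre_digraph \<Rightarrow> nat \<Rightarrow> 'a set \<Rightarrow> bool" where
  "dist_resolving G k S \<longleftrightarrow>
     S \<subseteq> pverts G \<and>
     (\<forall>x \<in> pverts G. \<forall>y \<in> pverts G. x \<noteq> y \<longrightarrow>
        (\<exists>z \<in> S. trunc_dist G k x z \<noteq> trunc_dist G k y z))"

definition dist_locating_dominating :: "'a pair_pre_digraph \<Rightarrow> nat \<Rightarrow> 'a set \<Rightarrow> bool" where
  "dist_locating_dominating G k S \<longleftrightarrow> dist_dominating G k S \<and> dist_resolving G k S"

text \<open>The minimum exists for finite graphs, since the full vertex set qualifies.\<close>

definition location_domination_number :: "'a pair_pre_digraph \<Rightarrow> nat \<Rightarrow> nat" where
  "location_domination_number G k = Min (card ` {S. dist_locating_dominating G k S})"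

text \<open>The arcs leaving \<open>v\<close> correspond to the edges at \<open>v\<close>, so the out-degree is the degree.\<close>

abbreviation degree :: "'a pair_pre_digraph \<Rightarrow> 'a \<Rightarrow> nat" where
  "degree G v \<equiv> out_degree (with_proj G) v"

definition leaf :: "'a pair_pre_digraph \<Rightarrow> 'a \<Rightarrow> bool" where
  "leaf G v \<longleftrightarrow> v \<in> pverts G \<and> degree G v = 1"

definition major_vertex :: "'a pair_pre_digraph \<Rightarrow> 'a \<Rightarrow> bool" where
  "major_vertex G v \<longleftrightarrow> v \<in> pverts G \<and> 3 \<le> degree G v"

definition terminal_vertex :: "'a pair_pre_digraph \<Rightarrow> 'a \<Rightarrow> 'a \<Rightarrow> bool" where
  "terminal_vertex G l v \<longleftrightarrow>
     leaf G l \<and> major_vertex G v \<and>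
     (\<forall>w. major_vertex G w \<and> w \<noteq> v \<longrightarrow> graph_dist G l v < graph_dist G l w)"

definition terminal_degree :: "'a pair_pre_digraph \<Rightarrow> 'a \<Rightarrow> nat" where
  "terminal_degree G v = card {l. terminal_vertex G l v}"

definition exterior_major_vertex :: "'a pair_pre_digraph \<Rightarrow> 'a \<Rightarrow> bool" where
  "exterior_major_vertex G v \<longleftrightarrow> major_vertex G v \<and> 0 < terminal_degree G v"

definition num_exterior_major :: "'a pair_pre_digraph \<Rightarrow> nat" where
  "num_exterior_major G = card {v. exterior_major_vertex G v}"

definition num_leaves :: "'a pair_pre_digraph \<Rightarrow> nat" where
  "num_leaves G = card {v. leaf G v}"

end

theory Submission
  imports Defs
begin

text \<open>
  The larger \<open>k\<close>, the weaker the condition of being distance-\<open>k\<close> locating-dominating, and for \<open>k = 1\<close>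
  the complement \<open>C\<close> of such a set is characterised by adjacency alone. A vertex that is neither a
  leaf nor an exterior major vertex allows a complement of size \<open>ex(T) + 1\<close> already for \<open>k = 1\<close>.
  If there is no such vertex, then \<open>C\<close> contains, for \<open>k = 1\<close>, at most one vertex of each star formed
  by an exterior major vertex and its leaves, while for \<open>k \<ge> 2\<close> one can take all exterior major
  vertices together with one of two leaves that share a neighbour. Only the existence of two such
  leaves uses that \<open>T\<close> has no cycles.
\<close>

section \<open>Adjacency, degrees and reachability in a connected graph\<close>

locale connected_pair_graph = pair_graph G for G :: "'a pair_pre_digraph" +
  assumes connected_graph: "Digraph_Component.connected (with_proj G)"
begin

abbreviation adj :: "'a \<Rightarrow> 'a \<Rightarrow> bool" where
  "adj x y \<equiv> (x, y) \<in> parcs G"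

lemma adj_commute: "adj x y \<longleftrightarrow> adj y x"
  using pair_sym_arcs by (auto simp: symmetric_def dest: symD)

lemma adj_in_verts: "adj x y \<Longrightarrow> x \<in> pverts G" "adj x y \<Longrightarrow> y \<in> pverts G"
  by (auto dest: in_arcsD1 in_arcsD2)

lemma not_adj_self: "\<not> adj x x"
  using pair_no_loops by fastforce

lemma finite_neighbours: "finite {y. adj x y}"
  by (rule finite_subset[OF _ pair_finite_verts]) (auto dest: adj_in_verts)

lemma degree_eq_card_neighbours: "degree G x = card {y. adj x y}"
proof -
  have "out_arcs (with_proj G) x = Pair x ` {y. adj x y}"
    by (auto simp: out_arcs_def)
  then show ?thesis
    by (simp add: out_degree_def card_image inj_on_def)
qed

lemma reachable_verts: "x \<in> pverts G \<Longrightarrow> y \<in> pverts G \<Longrightarrow> x \<rightarrow>\<^sup>*\<^bsub>with_proj G\<^esub> y"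
  using symmetric_connected_imp_strongly_connected[OF pair_sym_arcs connected_graph]
  by (auto simp: strongly_connected_def)

text \<open>Connectivity in the form used below to rule out small graphs: if a few vertices already
  contain all their neighbours, they are the whole graph.\<close>

lemma verts_subset_closed:
  assumes "a \<in> A" "a \<in> pverts G" and closed: "\<And>x y. x \<in> A \<Longrightarrow> adj x y \<Longrightarrow> y \<in> A"
  shows "pverts G \<subseteq> A"
proof
  fix y assume "y \<in> pverts G"
  with assms(2) have "a \<rightarrow>\<^sup>*\<^bsub>with_proj G\<^esub> y" by (rule reachable_verts)
  then show "y \<in> A"
    by (induction rule: reachable_induct) (use assms(1) closed in auto)
qed

lemma ex_neighbour:
  assumes "x \<in> pverts G" "card (pverts G) \<ge> 2"
  shows "\<exists>y. adj x y"
proof (rule ccontr)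
  assume "\<not> ?thesis"
  then have "pverts G \<subseteq> {x}"
    using assms(1) by (intro verts_subset_closed[of x]) auto
  then have "card (pverts G) \<le> card {x}" by (rule card_mono[rotated]) simp
  with assms(2) show False by simp
qed

section \<open>Distances 0, 1 and 2 in terms of adjacency\<close>

lemma graph_dist_apath:
  assumes "x \<in> pverts G" "y \<in> pverts G"
  obtains p where "apath x p y" "length p = graph_dist G x y"
proof -
  obtain p where "apath x p y"
    using reachable_verts[OF assms] by (auto simp: reachable_apath)
  then have "\<exists>m. \<exists>p. apath x p y \<and> length p = m" by blast
  then have "\<exists>p. apath x p y \<and> length p = graph_dist G x y"
    unfolding graph_dist_def by (rule LeastI_ex)
  then show ?thesis using that by blast
qed

lemma graph_dist_le: "apath x p y \<Longrightarrow> graph_dist G x y \<le> length p"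
  unfolding graph_dist_def by (rule Least_le) blast

lemma graph_dist_eq_0_iff:
  assumes "x \<in> pverts G" "y \<in> pverts G"
  shows "graph_dist G x y = 0 \<longleftrightarrow> x = y"
proof
  assume "graph_dist G x y = 0"
  then obtain p where "apath x p y" "p = []"
    using graph_dist_apath[OF assms] by auto
  then show "x = y" by (simp add: apath_Nil_iff)
next
  assume "x = y"
  then show "graph_dist G x y = 0"
    using graph_dist_le[of x "[]" y] assms by (simp add: apath_Nil_iff)
qed

lemma graph_dist_eq_1_iff:
  assumes "x \<in> pverts G" "y \<in> pverts G"
  shows "graph_dist G x y = 1 \<longleftrightarrow> adj x y"
proof
  assume "graph_dist G x y = 1"
  then obtain p where "apath x p y" "length p = 1"
    using graph_dist_apath[OF assms] by auto
  then show "adj x y"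
    by (cases p) (auto simp: apath_Cons_iff apath_Nil_iff)
next
  assume "adj x y"
  moreover then have "x \<noteq> y" by (auto simp: not_adj_self)
  ultimately have "graph_dist G x y \<le> 1"
    using graph_dist_le[of x "[(x, y)]" y] assms by (simp add: apath_simps)
  with \<open>x \<noteq> y\<close> show "graph_dist G x y = 1"
    using graph_dist_eq_0_iff[OF assms] by linarith
qed

lemma graph_dist_common_neighbour:
  assumes "adj x z" "adj z y"
  shows "graph_dist G x y \<le> 2"
proof (cases "x = y")
  case True
  then show ?thesis using graph_dist_eq_0_iff[of x y] adj_in_verts assms by simp
next
  case False
  have "x \<noteq> z" "z \<noteq> y" using assms by (auto simp: not_adj_self)
  with False have "apath x [(x, z), (z, y)] y"
    using assms by (simp add: apath_simps adj_in_verts)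
  then show ?thesis using graph_dist_le by fastforce
qed

section \<open>Leaves, major vertices and terminal vertices\<close>

lemma leaf_unique_neighbour:
  assumes "leaf G l" "adj l u" "adj l w"
  shows "u = w"
proof -
  have "card {y. adj l y} = 1"
    using assms(1) by (simp add: leaf_def degree_eq_card_neighbours)
  then obtain z where "{y. adj l y} = {z}" by (auto simp: card_1_singleton_iff)
  with assms(2,3) show ?thesis by (metis mem_Collect_eq singletonD)
qed

lemma leaf_obtain_neighbour:
  assumes "leaf G l"
  obtains u where "adj l u"
proof -
  have "card {y. adj l y} = 1"
    using assms(1) by (simp add: leaf_def degree_eq_card_neighbours)
  then obtain z where "{y. adj l y} = {z}" by (auto simp: card_1_singleton_iff)
  then show ?thesis using that by auto
qed

lemma major_not_leaf: "major_vertex G v \<Longrightarrow> \<not> leaf G v"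
  by (auto simp: major_vertex_def leaf_def)

text \<open>Two adjacent leaves are closed under adjacency and hence make up the whole graph; the
  major vertex \<open>m\<close> excludes this.\<close>

lemma leaf_neighbour_not_leaf:
  assumes "major_vertex G m" "leaf G l" "adj l u"
  shows "\<not> leaf G u"
proof
  assume "leaf G u"
  have "y \<in> {l, u}" if "x \<in> {l, u}" "adj x y" for x y
    using that assms \<open>leaf G u\<close> adj_commute leaf_unique_neighbour by blast
  then have "pverts G \<subseteq> {l, u}"
    using adj_in_verts(1)[OF assms(3)] by (intro verts_subset_closed[of l]) blast+
  then have "m = l \<or> m = u" using assms(1) by (auto simp: major_vertex_def)
  with assms \<open>leaf G u\<close> show False by (auto dest: major_not_leaf)
qed

text \<open>If \<open>u\<close> had degree at most two, the graph would be the path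
  \<open>l\<close>, \<open>u\<close>, \<open>l'\<close>, which has no room for the major vertex
  \<open>m\<close>.\<close>

lemma neighbour_of_two_leaves_major:
  assumes "major_vertex G m" "leaf G l" "leaf G l'" "l \<noteq> l'" "adj l u" "adj l' u"
  shows "major_vertex G u"
proof (rule ccontr)
  assume "\<not> ?thesis"
  then have deg: "card {y. adj u y} \<le> 2"
    using adj_in_verts(2)[OF assms(5)] by (simp add: major_vertex_def degree_eq_card_neighbours)
  have sub: "{l, l'} \<subseteq> {y. adj u y}" using assms adj_commute by auto
  have "{l, l'} = {y. adj u y}"
    by (rule card_seteq[OF finite_neighbours sub]) (use deg assms(4) in simp)
  then have "pverts G \<subseteq> {l, l', u}"
    using assms leaf_unique_neighbour
    by (intro verts_subset_closed[of l]) (auto dest: adj_in_verts)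
  then have "m = u" using assms(1-3) by (auto simp: major_vertex_def leaf_def)
  with assms(1) \<open>\<not> major_vertex G u\<close> show False by simp
qed

text \<open>Only \<open>l\<close> itself, which is not major, is at distance 0 from
  \<open>l\<close>, and only its unique neighbour \<open>u\<close> is at distance 1; every other
  major vertex is farther away.\<close>

lemma leaf_terminal_of_major_neighbour:
  assumes "leaf G l" "adj l u" "major_vertex G u"
  shows "terminal_vertex G l u"
  unfolding terminal_vertex_def
proof (intro conjI allI impI)
  fix w assume w: "major_vertex G w \<and> w \<noteq> u"
  have V: "l \<in> pverts G" "u \<in> pverts G" "w \<in> pverts G"
    using assms w by (auto simp: leaf_def major_vertex_def)
  have "graph_dist G l u = 1" using graph_dist_eq_1_iff V assms(2) by blast
  moreover have "graph_dist G l w \<noteq> 1"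
    using graph_dist_eq_1_iff V assms leaf_unique_neighbour w by blast
  moreover have "graph_dist G l w \<noteq> 0"
    using graph_dist_eq_0_iff V assms w major_not_leaf by blast
  ultimately show "graph_dist G l u < graph_dist G l w" by linarith
qed (use assms in auto)

lemma terminal_vertex_unique:
  "terminal_vertex G l v \<Longrightarrow> terminal_vertex G l w \<Longrightarrow> v = w"
  unfolding terminal_vertex_def by (metis less_asym)

lemma exterior_obtain_terminal:
  assumes "exterior_major_vertex G v"
  obtains l where "terminal_vertex G l v"
  using assms by (auto simp: exterior_major_vertex_def terminal_degree_def card_gt_0_iff)

lemma finite_exterior: "finite {v. exterior_major_vertex G v}"
  by (rule finite_subset[OF _ pair_finite_verts])
    (auto simp: exterior_major_vertex_def major_vertex_def)

lemma finite_leaves: "finite {v. leaf G v}"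
  by (rule finite_subset[OF _ pair_finite_verts]) (auto simp: leaf_def)

lemma exterior_leaf_disjoint: "{v. exterior_major_vertex G v} \<inter> {v. leaf G v} = {}"
  by (auto simp: exterior_major_vertex_def dest: major_not_leaf)

text \<open>Turns the counting condition of the theorem into a covering condition: leaves and
  exterior major vertices are disjoint sets, so their numbers add up to the order exactly if
  together they exhaust the vertices.\<close>

lemma exterior_leaf_cover_iff:
  "num_exterior_major G + num_leaves G = card (pverts G) \<longleftrightarrow>
     (\<forall>v\<in>pverts G. exterior_major_vertex G v \<or> leaf G v)"
proof -
  let ?U = "{v. exterior_major_vertex G v} \<union> {v. leaf G v}"
  have card: "card ?U = num_exterior_major G + num_leaves G"
    unfolding num_exterior_major_def num_leaves_def
    by (rule card_Un_disjoint[OF finite_exterior finite_leaves exterior_leaf_disjoint])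
  have sub: "?U \<subseteq> pverts G"
    by (auto simp: exterior_major_vertex_def major_vertex_def leaf_def)
  have "card ?U = card (pverts G) \<longleftrightarrow> ?U = pverts G"
    using card_subset_eq[OF pair_finite_verts sub] by auto
  also have "\<dots> \<longleftrightarrow> (\<forall>v\<in>pverts G. exterior_major_vertex G v \<or> leaf G v)"
    using sub by auto
  finally show ?thesis by (simp add: card)
qed

section \<open>Locating-dominating sets described by their complements\<close>

lemma trunc_dist_eq_0_iff:
  assumes "x \<in> pverts G" "y \<in> pverts G"
  shows "trunc_dist G k x y = 0 \<longleftrightarrow> x = y"
  using graph_dist_eq_0_iff[OF assms] by (auto simp: trunc_dist_def min_def)

lemma trunc_dist_eq_1_iff:
  assumes "x \<in> pverts G" "y \<in> pverts G" "k \<ge> 1"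
  shows "trunc_dist G k x y = 1 \<longleftrightarrow> adj x y"
  using graph_dist_eq_1_iff[OF assms(1,2)] assms(3) by (auto simp: trunc_dist_def min_def)

text \<open>A vertex of the set is the only one at distance 0 from itself and so resolves every pair
  it belongs to. Only pairs inside the complement \<open>C\<close> remain to be checked.\<close>

lemma locating_dominating_complement_iff:
  assumes "C \<subseteq> pverts G"
  shows "dist_locating_dominating G k (pverts G - C) \<longleftrightarrow>
    (\<forall>c\<in>C. \<exists>s\<in>pverts G - C. graph_dist G c s \<le> k) \<and>
    (\<forall>c\<in>C. \<forall>c'\<in>C. c \<noteq> c' \<longrightarrow> (\<exists>s\<in>pverts G - C. trunc_dist G k c s \<noteq> trunc_dist G k c' s))"
    (is "?L \<longleftrightarrow> ?D \<and> ?R")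
proof -
  have "pverts G - (pverts G - C) = C" using assms by auto
  then have "dist_dominating G k (pverts G - C) \<longleftrightarrow> ?D"
    by (simp add: dist_dominating_def)
  moreover have "dist_resolving G k (pverts G - C) \<longleftrightarrow> ?R"
  proof
    assume "dist_resolving G k (pverts G - C)"
    with assms show ?R unfolding dist_resolving_def by blast
  next
    assume R: ?R
    show "dist_resolving G k (pverts G - C)"
      unfolding dist_resolving_def
    proof (intro conjI ballI impI)
      fix x y assume xy: "x \<in> pverts G" "y \<in> pverts G" "x \<noteq> y"
      have self: "trunc_dist G k x x \<noteq> trunc_dist G k y x" "trunc_dist G k x y \<noteq> trunc_dist G k y y"
        using trunc_dist_eq_0_iff[of x x k] trunc_dist_eq_0_iff[of y x k]
          trunc_dist_eq_0_iff[of y y k] trunc_dist_eq_0_iff[of x y k] xy by auto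
      show "\<exists>z\<in>pverts G - C. trunc_dist G k x z \<noteq> trunc_dist G k y z"
      proof (cases "x \<in> C \<and> y \<in> C")
        case True
        with R xy show ?thesis by blast
      next
        case False
        with self xy show ?thesis by blast
      qed
    qed auto
  qed
  ultimately show ?thesis by (simp add: dist_locating_dominating_def)
qed

text \<open>A vertex of \<open>C\<close> and one outside \<open>C\<close> are distinct, so their
  distance truncated at 2 is 1 or 2 and records exactly whether they are adjacent.\<close>

lemma locating_dominating_1_complement_iff:
  assumes "C \<subseteq> pverts G"
  shows "dist_locating_dominating G 1 (pverts G - C) \<longleftrightarrow>
    (\<forall>c\<in>C. \<exists>s. adj c s \<and> s \<notin> C) \<and>
    (\<forall>c\<in>C. \<forall>c'\<in>C. c \<noteq> c' \<longrightarrow> (\<exists>s. s \<notin> C \<and> adj c s \<noteq> adj c' s))"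
proof -
  have near: "graph_dist G c s \<le> 1 \<longleftrightarrow> adj c s" if "c \<in> C" "s \<in> pverts G - C" for c s
    using that assms graph_dist_eq_1_iff[of c s] graph_dist_eq_0_iff[of c s]
    by (metis DiffD1 DiffD2 le_eq_less_or_eq less_one subsetD)
  have res: "trunc_dist G 1 c s = trunc_dist G 1 c' s \<longleftrightarrow> adj c s = adj c' s"
    if "c \<in> C" "c' \<in> C" "s \<in> pverts G - C" for c c' s
  proof -
    have val: "trunc_dist G 1 x s = (if adj x s then 1 else 2)" if "x \<in> C" for x
      using that \<open>s \<in> pverts G - C\<close> assms graph_dist_eq_1_iff[of x s] graph_dist_eq_0_iff[of x s]
      by (cases "adj x s"; cases "graph_dist G x s") (auto simp: trunc_dist_def)
    show ?thesis unfolding val[OF that(1)] val[OF that(2)] by simp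
  qed
  have "(\<exists>s\<in>pverts G - C. graph_dist G c s \<le> 1) \<longleftrightarrow> (\<exists>s. adj c s \<and> s \<notin> C)" if "c \<in> C" for c
    using near[OF that] adj_in_verts(2)[of c] by blast
  moreover have "(\<exists>s\<in>pverts G - C. trunc_dist G 1 c s \<noteq> trunc_dist G 1 c' s) \<longleftrightarrow>
      (\<exists>s. s \<notin> C \<and> adj c s \<noteq> adj c' s)" if "c \<in> C" "c' \<in> C" for c c'
    using res[OF that] adj_in_verts(2)[of c] adj_in_verts(2)[of c'] by blast
  ultimately show ?thesis
    unfolding locating_dominating_complement_iff[OF assms] by simp
qed

text \<open>Truncating at \<open>j + 1\<close> factors through truncating at \<open>k + 1\<close>,
  so whatever is told apart for \<open>j\<close> is told apart for \<open>k\<close>.\<close>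

lemma locating_dominating_mono:
  assumes "dist_locating_dominating G j S" "j \<le> k"
  shows "dist_locating_dominating G k S"
proof -
  have "trunc_dist G j x z = min (trunc_dist G k x z) (j + 1)" for x z
    using assms(2) by (simp add: trunc_dist_def min_def)
  then have "trunc_dist G k x z \<noteq> trunc_dist G k y z" if "trunc_dist G j x z \<noteq> trunc_dist G j y z" for x y z
    using that by metis
  with assms show ?thesis
    unfolding dist_locating_dominating_def dist_dominating_def dist_resolving_def
    by (meson le_trans)
qed

section \<open>Bounds on the location-domination number\<close>

lemma finite_locating_dominating: "finite {S. dist_locating_dominating G k S}"
  by (rule finite_subset[of _ "Pow (pverts G)"])
    (auto simp: dist_locating_dominating_def dist_dominating_def pair_finite_verts)

lemma location_domination_number_le:
  assumes "C \<subseteq> pverts G" "dist_locating_dominating G k (pverts G - C)"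
  shows "location_domination_number G k + card C \<le> card (pverts G)"
proof -
  have "location_domination_number G k \<le> card (pverts G - C)"
    unfolding location_domination_number_def
    by (rule Min_le) (use assms(2) finite_locating_dominating in auto)
  moreover have "card C \<le> card (pverts G)" using assms(1) pair_finite_verts by (rule card_mono[rotated])
  ultimately show ?thesis
    using card_Diff_subset[OF finite_subset[OF assms(1) pair_finite_verts] assms(1)] by simp
qed

lemma location_domination_number_attained:
  obtains C where "C \<subseteq> pverts G" "dist_locating_dominating G k (pverts G - C)"
    "location_domination_number G k + card C = card (pverts G)"
proof -
  let ?F = "{S. dist_locating_dominating G k S}"
  have "pverts G \<in> ?F"
    using locating_dominating_complement_iff[of "{}" k] by simp
  then have "card ` ?F \<noteq> {}" by blast
  then have "location_domination_number G k \<in> card ` ?F"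
    unfolding location_domination_number_def
    using finite_locating_dominating by (intro Min_in) auto
  then obtain S where S: "dist_locating_dominating G k S" "location_domination_number G k = card S"
    by auto
  then have sub: "S \<subseteq> pverts G"
    by (simp add: dist_locating_dominating_def dist_dominating_def)
  have "pverts G - (pverts G - S) = S" using sub by auto
  moreover have "card S + card (pverts G - S) = card (pverts G)"
    using card_Diff_subset[OF finite_subset[OF sub pair_finite_verts] sub]
      card_mono[OF pair_finite_verts sub] by simp
  ultimately show ?thesis
    using S by (intro that[of "pverts G - S"]) auto
qed

text \<open>A single vertex can always be left out, since it has a neighbour. In the theorem this
  forces at least one exterior major vertex.\<close>

lemma location_domination_number_less_order:
  assumes "card (pverts G) \<ge> 2" "k \<ge> 1"
  shows "location_domination_number G k < card (pverts G)"
proof -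
  obtain x where x: "x \<in> pverts G"
    using assms(1) by (metis all_not_in_conv card.empty not_numeral_le_zero)
  then obtain y where "adj x y" using ex_neighbour assms(1) by blast
  then have "dist_locating_dominating G 1 (pverts G - {x})"
    using x not_adj_self by (subst locating_dominating_1_complement_iff) auto
  then have "dist_locating_dominating G k (pverts G - {x})"
    using assms(2) by (rule locating_dominating_mono)
  with location_domination_number_le[of "{x}" k] x show ?thesis by simp
qed

section \<open>A complement of size \<open>ex + 1\<close> when some vertex is neither a leaf nor
  exterior major\<close>

lemma two_elements_outside_neighbourhood:
  assumes "s \<noteq> s'" "adj w s" "adj w s'" "s \<notin> C" "s' \<notin> C" "leaf G l"
  shows "\<exists>s. s \<notin> C \<and> adj w s \<and> \<not> adj l s"
  using assms leaf_unique_neighbour by blast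

text \<open>
  Removing one terminal vertex per exterior major vertex leaves a locating-dominating set; the
  vertex \<open>w\<close> can be removed as well, unless it is adjacent to the removed terminal vertex of some
  \<open>v\<close>, in which case \<open>v\<close> is removed in place of that terminal vertex.
\<close>

lemma ex_large_complement:
  assumes m: "exterior_major_vertex G m"
    and w: "w \<in> pverts G" "\<not> leaf G w" "\<not> exterior_major_vertex G w"
  shows "\<exists>C \<subseteq> pverts G. card C = Suc (num_exterior_major G) \<and>
    dist_locating_dominating G 1 (pverts G - C)"
proof -
  define E where "E = {v. exterior_major_vertex G v}"
  have major: "major_vertex G m" using m by (simp add: exterior_major_vertex_def)
  have E_major: "major_vertex G v" if "v \<in> E" for v
    using that by (simp add: E_def exterior_major_vertex_def)
  have "\<forall>v\<in>E. \<exists>l. terminal_vertex G l v"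
    using exterior_obtain_terminal unfolding E_def by blast
  then obtain t where t: "\<And>v. v \<in> E \<Longrightarrow> terminal_vertex G (t v) v" by metis
  then have leaf_t: "leaf G (t v)" if "v \<in> E" for v
    using that by (simp add: terminal_vertex_def)
  have inj_t: "inj_on t E" using t terminal_vertex_unique by (metis inj_onI)
  have E_verts: "E \<subseteq> pverts G" using E_major by (auto simp: major_vertex_def)
  have finE: "finite E" unfolding E_def by (rule finite_exterior)
  \<comment> \<open>The chosen terminal vertices have distinct neighbours: a common neighbour of two
    of them would be major, hence the one major vertex to which both belong.\<close>
  have t_eq: "v = v'" if "v \<in> E" "v' \<in> E" "adj (t v) u" "adj (t v') u" for v v' u
  proof (cases "t v = t v'")
    case True
    with inj_t that show ?thesis by (simp add: inj_on_def)
  next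
    case False
    then have "major_vertex G u"
      using neighbour_of_two_leaves_major major leaf_t that by blast
    then have "terminal_vertex G (t v) u" "terminal_vertex G (t v') u"
      using leaf_terminal_of_major_neighbour leaf_t that by auto
    then show ?thesis using t that terminal_vertex_unique by blast
  qed
  show ?thesis
  proof (cases "\<exists>v\<in>E. adj w (t v)")
    case False
    define C where "C = insert w (t ` E)"
    have "w \<notin> t ` E" using w leaf_t by auto
    then have card: "card C = Suc (num_exterior_major G)"
      using finE inj_t by (simp add: C_def card_image num_exterior_major_def E_def)
    have sub: "C \<subseteq> pverts G" using w leaf_t by (auto simp: C_def leaf_def)
    \<comment> \<open>The degree of \<open>w\<close> is not 1, as \<open>w\<close> is not a leaf,
      and not 0, as \<open>m\<close> is a second vertex. Its two neighbours then lie outside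
      \<open>C\<close> by the case assumption.\<close>
    have "card {y. adj w y} \<noteq> 1"
      using w by (simp add: leaf_def degree_eq_card_neighbours)
    moreover have "card (pverts G) \<ge> 2"
      using card_mono[OF pair_finite_verts, of "{w, m}"] w m major
      by (auto simp: major_vertex_def card_insert_if split: if_splits)
    then have "card {y. adj w y} \<noteq> 0"
      using ex_neighbour[OF w(1)] finite_neighbours by auto
    ultimately have "card {y. adj w y} \<ge> 2" by linarith
    then obtain s s' where s: "adj w s" "adj w s'" "s \<noteq> s'"
      by (auto simp: card_le_Suc_iff numeral_2_eq_2)
    have s_out: "s \<notin> C" "s' \<notin> C" using s False not_adj_self by (auto simp: C_def)
    have t_nbr: "\<exists>u. adj (t v) u \<and> u \<notin> C" if v: "v \<in> E" for v
    proof -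
      obtain u where u: "adj (t v) u" using leaf_obtain_neighbour leaf_t v by blast
      then have "\<not> leaf G u" using leaf_neighbour_not_leaf major leaf_t v by blast
      then have "u \<notin> C" using False v u leaf_t adj_commute by (auto simp: C_def)
      with u show ?thesis by blast
    qed
    have sep_w: "\<exists>s. s \<notin> C \<and> adj w s \<and> \<not> adj (t v) s" if "v \<in> E" for v
      using two_elements_outside_neighbourhood s s_out leaf_t that by blast
    have sep_t: "\<exists>s. s \<notin> C \<and> adj (t v) s \<and> \<not> adj (t v') s" if "v \<in> E" "v' \<in> E" "v \<noteq> v'" for v v'
      using t_nbr t_eq that by blast
    have "dist_locating_dominating G 1 (pverts G - C)"
      unfolding locating_dominating_1_complement_iff[OF sub]
    proof (intro conjI ballI impI)
      fix c assume "c \<in> C"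
      then show "\<exists>s. adj c s \<and> s \<notin> C" using t_nbr s s_out by (auto simp: C_def)
    next
      fix c c' assume "c \<in> C" "c' \<in> C" "c \<noteq> c'"
      then consider v where "c = w" "c' = t v" "v \<in> E" | v where "c' = w" "c = t v" "v \<in> E"
        | v v' where "c = t v" "c' = t v'" "v \<in> E" "v' \<in> E" "v \<noteq> v'"
        by (auto simp: C_def)
      then show "\<exists>s. s \<notin> C \<and> adj c s \<noteq> adj c' s"
        by cases (use sep_w sep_t in blast)+
    qed
    with card sub show ?thesis by blast
  next
    case True
    then obtain v where v: "v \<in> E" "adj w (t v)" by blast
    \<comment> \<open>With \<open>v\<close> in place of \<open>t v\<close>, the leaf
      \<open>t v\<close> stays in the set. Its only neighbour is \<open>w\<close>, so it dominates
      \<open>w\<close> and separates it from every other vertex.\<close>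
    define F where "F = E - {v}"
    define C where "C = insert v (insert w (t ` F))"
    have F: "u \<in> E" "u \<noteq> v" if "u \<in> F" for u using that by (auto simp: F_def)
    have "w \<notin> t ` F" using w(2) leaf_t F by blast
    moreover have "v \<notin> t ` F" using E_major[OF v(1)] major_not_leaf leaf_t F by blast
    moreover have "v \<noteq> w" using v(1) w(3) by (auto simp: E_def)
    moreover have "card (t ` F) = card E - 1"
      using inj_t v finE by (simp add: F_def card_image inj_on_diff card_Diff_singleton)
    moreover have "card E > 0" using v finE by (auto simp: card_gt_0_iff)
    ultimately have card: "card C = Suc (num_exterior_major G)"
      using finE by (simp add: C_def F_def num_exterior_major_def flip: E_def)
    have sub: "C \<subseteq> pverts G" using w leaf_t F v E_verts by (auto simp: C_def leaf_def)
    have tv: "adj (t v) y \<longleftrightarrow> y = w" for y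
      using v leaf_t adj_commute leaf_unique_neighbour by blast
    have "t v \<notin> t ` F" using inj_t v(1) by (auto simp: F_def inj_on_def)
    then have tv_out: "t v \<notin> C"
      using leaf_t[OF v(1)] w(2) major_not_leaf[OF E_major[OF v(1)]] by (auto simp: C_def)
    \<comment> \<open>A leaf adjacent to \<open>v\<close> has \<open>v\<close> as its major vertex,
      whereas \<open>t u\<close> belongs to \<open>u\<close>.\<close>
    have v_t: "\<not> adj v (t u)" if u: "u \<in> F" for u
    proof
      assume "adj v (t u)"
      then have "terminal_vertex G (t u) v"
        using leaf_t[OF F(1)[OF u]] E_major[OF v(1)] adj_commute
        by (intro leaf_terminal_of_major_neighbour) auto
      then show False using t F u terminal_vertex_unique by blast
    qed
    have "card {y. adj v y} \<ge> 3"
      using E_major[OF v(1)] by (simp add: major_vertex_def degree_eq_card_neighbours)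
    \<comment> \<open>By \<open>v_t\<close>, the only possible neighbour of \<open>v\<close> in
      \<open>C\<close> is \<open>w\<close>; degree three therefore leaves two neighbours outside
      \<open>C\<close>, and a leaf is adjacent to at most one of them.\<close>
    then have "card ({y. adj v y} - {w}) \<ge> 2"
      using diff_card_le_card_Diff[of "{w}" "{y. adj v y}"] by simp
    then obtain s s' where s: "adj v s" "s \<noteq> w" "adj v s'" "s' \<noteq> w" "s \<noteq> s'"
      by (auto simp: card_le_Suc_iff numeral_2_eq_2)
    have s_out: "s \<notin> C" "s' \<notin> C" using s v_t not_adj_self by (auto simp: C_def)
    have t_nbr: "\<exists>x. adj (t u) x \<and> x \<notin> C" if u: "u \<in> F" for u
    proof -
      obtain x where x: "adj (t u) x" using leaf_obtain_neighbour leaf_t F u by blast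
      then have "\<not> leaf G x" using leaf_neighbour_not_leaf major leaf_t F u by blast
      moreover have "x \<noteq> v" using x v_t u adj_commute by blast
      \<comment> \<open>Otherwise \<open>t u\<close> and \<open>t v\<close> would share the
        neighbour \<open>w\<close>, against \<open>t_eq\<close>.\<close>
      moreover have "x \<noteq> w" using x t_eq[of u v w] F u v adj_commute by blast
      ultimately have "x \<notin> C" using leaf_t F by (auto simp: C_def)
      with x show ?thesis by blast
    qed
    have sep_w: "t v \<notin> C \<and> adj w (t v) \<and> \<not> adj c (t v)" if "c \<noteq> w" for c
      using tv tv_out v that adj_commute by blast
    have sep_v: "\<exists>s. s \<notin> C \<and> adj v s \<and> \<not> adj (t u) s" if "u \<in> F" for u
      using two_elements_outside_neighbourhood s s_out leaf_t F that by blast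
    have sep_t: "\<exists>s. s \<notin> C \<and> adj (t u) s \<and> \<not> adj (t u') s" if "u \<in> F" "u' \<in> F" "u \<noteq> u'" for u u'
      using t_nbr t_eq that F by blast
    have "dist_locating_dominating G 1 (pverts G - C)"
      unfolding locating_dominating_1_complement_iff[OF sub]
    proof (intro conjI ballI impI)
      fix c assume "c \<in> C"
      then show "\<exists>s. adj c s \<and> s \<notin> C"
        using t_nbr s s_out v tv_out by (auto simp: C_def)
    next
      fix c c' assume "c \<in> C" "c' \<in> C" "c \<noteq> c'"
      then consider "c = w" "c' \<noteq> w" | "c' = w" "c \<noteq> w"
        | u where "c = v" "c' = t u" "u \<in> F" | u where "c' = v" "c = t u" "u \<in> F"
        | u u' where "c = t u" "c' = t u'" "u \<in> F" "u' \<in> F" "u \<noteq> u'"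
        by (auto simp: C_def)
      then show "\<exists>s. s \<notin> C \<and> adj c s \<noteq> adj c' s"
        by cases (use sep_w sep_v sep_t in blast)+
    qed
    with card sub show ?thesis by blast
  qed
qed

section \<open>Two leaves with a common neighbour, from acyclicity\<close>

text \<open>The first vertex of a longest path inside \<open>I\<close> has all its neighbours in \<open>I\<close> on that path.\<close>

lemma acyclic_ex_low_degree:
  assumes acyclic: "\<not> (\<exists>p. cycle p \<and> 3 \<le> length p)"
    and I: "I \<subseteq> pverts G" "I \<noteq> {}"
  shows "\<exists>u\<in>I. card {x \<in> I. adj u x} \<le> 1"
proof -
  \<comment> \<open>Paths are packed into triples so that the maximum is taken over both endpoints
    as well; their lengths are bounded by the order of the graph.\<close>
  define P where "P = (\<lambda>(u, p, v). apath u p v \<and> set (pawalk_verts u p) \<subseteq> I)"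
  obtain i where "i \<in> I" using I by blast
  then have "P (i, [], i)" using I by (auto simp: P_def apath_Nil_iff)
  moreover have "\<forall>z. P z \<longrightarrow> length (fst (snd z)) < Suc (card (pverts G))"
    using length_apath by (auto simp: P_def less_Suc_eq_le)
  ultimately obtain z where z: "P z" "\<And>y. P y \<Longrightarrow> length (fst (snd y)) \<le> length (fst (snd z))"
    using ex_has_greatest_nat[of P _ "\<lambda>z. length (fst (snd z))"] by blast
  obtain u p v where z_eq: "z = (u, p, v)" by (cases z) auto
  with z have path: "apath u p v" and in_I: "set (pawalk_verts u p) \<subseteq> I" by (auto simp: P_def)
  have awalk: "awalk u p v" using path by (rule awalkI_apath)
  then have u: "u \<in> I" using in_I hd_in_awalk_verts(1) by blast
  have on_path: "x \<in> set (pawalk_verts u p)" if x: "x \<in> I" "adj u x" for x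
  proof (rule ccontr)
    assume "x \<notin> set (pawalk_verts u p)"
    then have "P (x, (x, u) # p, v)"
      using path in_I x adj_commute by (auto simp: P_def apath_Cons_iff)
    then show False using z(2) z_eq by fastforce
  qed
  have first: "\<exists>r. p = (u, x) # r" if x: "x \<in> I" "adj u x" for x
  proof -
    obtain q r where qr: "p = q @ r" "awalk u q x"
      using awalk_decomp[OF awalk on_path[OF x]] by blast
    have "q \<noteq> []" using qr(2) x not_adj_self by (auto simp: awalk_Nil_iff)
    have "apath u q x"
      using path qr apath_append_iff[of u q r v] by auto
    \<comment> \<open>The arc from \<open>x\<close> back to \<open>u\<close> closes the initial
      piece \<open>q\<close> to a cycle of length one more than that of \<open>q\<close>. Acyclicity
      leaves only \<open>q\<close> of length 1, so \<open>x\<close> is the second vertex of the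
      path.\<close>
    then have "cycle ((x, u) # q)"
      unfolding cycle_def using qr(2) x adj_commute
      by (intro exI[of _ x]) (auto simp: awalk_Cons_iff apath_def)
    with acyclic have "length q < 2" by fastforce
    with \<open>q \<noteq> []\<close> obtain e where "q = [e]" by (cases q) auto
    then have "q = [(u, x)]" using qr(2) by (cases e) (auto simp: awalk_simps)
    with qr(1) show ?thesis by simp
  qed
  have "x = y" if "x \<in> I" "adj u x" "y \<in> I" "adj u y" for x y
    using first[OF that(1,2)] first[OF that(3,4)] by auto
  then have "card {x \<in> I. adj u x} \<le> 1"
    by (auto simp: card_le_Suc0_iff_eq finite_subset[OF I(1) pair_finite_verts])
  with u show ?thesis by blast
qed

text \<open>Some non-leaf has at most one non-leaf neighbour. By the covering assumption it is
  major, so at least two of its three or more neighbours are leaves.\<close>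

lemma acyclic_ex_twin_leaves:
  assumes acyclic: "\<not> (\<exists>p. cycle p \<and> 3 \<le> length p)"
    and m: "major_vertex G m" and cover: "\<And>v. v \<in> pverts G \<Longrightarrow> major_vertex G v \<or> leaf G v"
  shows "\<exists>u l l'. leaf G l \<and> leaf G l' \<and> l \<noteq> l' \<and> adj u l \<and> adj u l'"
proof -
  let ?I = "{v \<in> pverts G. \<not> leaf G v}"
  have "m \<in> ?I" using m major_not_leaf by (simp add: major_vertex_def)
  then obtain u where u: "u \<in> ?I" "card {x \<in> ?I. adj u x} \<le> 1"
    using acyclic_ex_low_degree[OF acyclic, of ?I] by blast
  then have "card {y. adj u y} \<ge> 3"
    using cover by (auto simp: major_vertex_def degree_eq_card_neighbours)
  moreover have "card ({y. adj u y} - {x \<in> ?I. adj u x}) \<ge> card {y. adj u y} - card {x \<in> ?I. adj u x}"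
    by (rule diff_card_le_card_Diff) (auto simp: pair_finite_verts)
  ultimately have "card ({y. adj u y} - {x \<in> ?I. adj u x}) \<ge> 2" using u(2) by linarith
  moreover have "{y. adj u y} - {x \<in> ?I. adj u x} = {y. adj u y \<and> leaf G y}"
    by (auto dest: adj_in_verts)
  ultimately have "card {y. adj u y \<and> leaf G y} \<ge> 2" by simp
  then have "\<not> card {y. adj u y \<and> leaf G y} \<le> Suc 0" by simp
  moreover have "finite {y. adj u y \<and> leaf G y}"
    by (rule finite_subset[OF _ finite_neighbours]) auto
  ultimately show ?thesis by (auto simp: card_le_Suc0_iff_eq)
qed

section \<open>Graphs in which every vertex is a leaf or exterior major\<close>

context
  assumes exterior_nonempty: "\<exists>m. exterior_major_vertex G m"
    and cover: "\<And>v. v \<in> pverts G \<Longrightarrow> exterior_major_vertex G v \<or> leaf G v"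
begin

lemma leaf_neighbour_exterior:
  assumes "leaf G l" "adj l u"
  shows "exterior_major_vertex G u"
  using assms exterior_nonempty cover[of u] leaf_neighbour_not_leaf adj_in_verts(2)
  by (auto simp: exterior_major_vertex_def)

text \<open>In general a terminal vertex may be far from its major vertex. Here the neighbour of the
  leaf is itself major, so by uniqueness it is \<open>v\<close>.\<close>

lemma exterior_leaf_neighbour:
  assumes "exterior_major_vertex G v"
  shows "\<exists>l. leaf G l \<and> adj v l"
proof -
  obtain l where l: "terminal_vertex G l v" using assms by (rule exterior_obtain_terminal)
  then have "leaf G l" by (simp add: terminal_vertex_def)
  moreover then obtain u where u: "adj l u" by (rule leaf_obtain_neighbour)
  ultimately have "terminal_vertex G l u"
    using leaf_neighbour_exterior leaf_terminal_of_major_neighbour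
    by (auto simp: exterior_major_vertex_def)
  with l have "u = v" using terminal_vertex_unique by blast
  with u \<open>leaf G l\<close> show ?thesis using adj_commute by blast
qed

lemma leaf_not_exterior: "leaf G l \<Longrightarrow> \<not> exterior_major_vertex G l"
  using exterior_leaf_disjoint by auto

lemma exterior_in_verts: "exterior_major_vertex G v \<Longrightarrow> v \<in> pverts G"
  by (simp add: exterior_major_vertex_def major_vertex_def)

lemma location_domination_number_1:
  "location_domination_number G 1 + num_exterior_major G = card (pverts G)"
proof (rule antisym)
  let ?E = "{v. exterior_major_vertex G v}"
  have sub: "?E \<subseteq> pverts G" using exterior_in_verts by blast
  \<comment> \<open>A leaf attached to \<open>v\<close> is a private neighbour: it dominates
    \<open>v\<close> and separates it from all other exterior major vertices.\<close>
  have "\<exists>s. adj v s \<and> s \<notin> ?E \<and> (\<forall>v'. v' \<noteq> v \<longrightarrow> \<not> adj v' s)" if "v \<in> ?E" for v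
    using that exterior_leaf_neighbour[of v] leaf_not_exterior leaf_unique_neighbour adj_commute
    by blast
  then have "dist_locating_dominating G 1 (pverts G - ?E)"
    unfolding locating_dominating_1_complement_iff[OF sub] by metis
  from location_domination_number_le[OF sub this]
  show "location_domination_number G 1 + num_exterior_major G \<le> card (pverts G)"
    by (simp add: num_exterior_major_def)
next
  let ?E = "{v. exterior_major_vertex G v}"
  obtain C where sub: "C \<subseteq> pverts G" and C: "dist_locating_dominating G 1 (pverts G - C)"
    and card: "location_domination_number G 1 + card C = card (pverts G)"
    by (rule location_domination_number_attained)
  have dom: "\<exists>s. adj c s \<and> s \<notin> C" if "c \<in> C" for c
    using C that unfolding locating_dominating_1_complement_iff[OF sub] by blast
  have res: "\<exists>s. s \<notin> C \<and> adj c s \<noteq> adj c' s" if "c \<in> C" "c' \<in> C" "c \<noteq> c'" for c c'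
    using C that unfolding locating_dominating_1_complement_iff[OF sub] by blast
  have "\<forall>c. leaf G c \<longrightarrow> (\<exists>u. adj c u)" using leaf_obtain_neighbour by blast
  then obtain g where g: "\<And>c. leaf G c \<Longrightarrow> adj c (g c)" by metis
  \<comment> \<open>Sends each vertex to the centre of its star, so that injectivity on
    \<open>C\<close> bounds the size of \<open>C\<close> by the number of stars.\<close>
  define f where "f = (\<lambda>c. if leaf G c then g c else c)"
  have g_iff: "adj c y \<longleftrightarrow> y = g c" if "leaf G c" for c y
    using g that leaf_unique_neighbour by blast
  have g_out: "g c \<notin> C" if "leaf G c" "c \<in> C" for c
    using dom[OF that(2)] g_iff[OF that(1)] by simp
  \<comment> \<open>A leaf in \<open>C\<close> must be dominated by its only neighbour, so the
    centre is not in \<open>C\<close> as well; two leaves in \<open>C\<close> with the same centre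
    would have equal neighbourhoods and not be resolved.\<close>
  have "inj_on f C"
  proof (rule inj_onI, rule ccontr)
    fix c c' assume c: "c \<in> C" "c' \<in> C" "f c = f c'" "c \<noteq> c'"
    then have "leaf G c" "leaf G c'"
      using g_out by (auto simp: f_def split: if_splits)
    with c res[OF c(1,2,4)] show False by (simp add: f_def g_iff)
  qed
  moreover have "f ` C \<subseteq> ?E"
    using cover sub g leaf_neighbour_exterior by (auto simp: f_def)
  ultimately have "card C \<le> num_exterior_major G"
    unfolding num_exterior_major_def using finite_exterior by (rule card_inj_on_le)
  with card show "card (pverts G) \<le> location_domination_number G 1 + num_exterior_major G"
    by simp
qed

lemma location_domination_number_ge_2:
  assumes acyclic: "\<not> (\<exists>p. cycle p \<and> 3 \<le> length p)" and k: "k \<ge> 2"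
  shows "location_domination_number G k + num_exterior_major G < card (pverts G)"
proof -
  let ?E = "{v. exterior_major_vertex G v}"
  obtain u l l' where twins: "leaf G l" "leaf G l'" "l \<noteq> l'" "adj u l" "adj u l'"
    using acyclic_ex_twin_leaves[OF acyclic] exterior_nonempty cover
    unfolding exterior_major_vertex_def by blast
  \<comment> \<open>Although its neighbour \<open>u\<close> is in \<open>C\<close>, the leaf
    \<open>l\<close> is dominated by its twin \<open>l'\<close> at distance at most 2; this is where
    \<open>k\<close> at least 2 enters.\<close>
  define C where "C = insert l ?E"
  have sub: "C \<subseteq> pverts G"
    using exterior_in_verts twins by (auto simp: C_def leaf_def)
  have card: "card C = Suc (num_exterior_major G)"
    using finite_exterior leaf_not_exterior twins by (simp add: C_def num_exterior_major_def)
  have l_only: "v = u" if "adj v l" for v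
    using that twins adj_commute leaf_unique_neighbour by blast
  \<comment> \<open>Putting \<open>l\<close> into \<open>C\<close> costs only \<open>u\<close> a
    leaf neighbour, and \<open>u\<close> still has \<open>l'\<close>; so each exterior major vertex
    keeps a private leaf outside \<open>C\<close>.\<close>
  have support: "\<exists>s\<in>pverts G - C. adj v s \<and> (\<forall>c\<in>C. c \<noteq> v \<longrightarrow> \<not> adj c s)"
    if v: "exterior_major_vertex G v" for v
  proof -
    obtain s where s: "leaf G s" "adj v s" "s \<noteq> l"
      using exterior_leaf_neighbour[OF v] twins l_only by metis
    then have "s \<in> pverts G - C" using leaf_not_exterior by (auto simp: C_def leaf_def)
    moreover have "\<not> adj c s" if "c \<noteq> v" for c
      using s that adj_commute leaf_unique_neighbour by blast
    ultimately show ?thesis using s by blast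
  qed
  have sep: "\<exists>s\<in>pverts G - C. trunc_dist G k v s \<noteq> trunc_dist G k c s"
    if v: "exterior_major_vertex G v" and c: "c \<in> C" "c \<noteq> v" for v c
  proof -
    obtain s where s: "s \<in> pverts G - C" "adj v s" "\<not> adj c s"
      using support[OF v] c by blast
    then have "trunc_dist G k v s = 1" "trunc_dist G k c s \<noteq> 1"
      using trunc_dist_eq_1_iff[of v s k] trunc_dist_eq_1_iff[of c s k] k c sub
        exterior_in_verts[OF v] by auto
    with s show ?thesis by metis
  qed
  have "dist_locating_dominating G k (pverts G - C)"
    unfolding locating_dominating_complement_iff[OF sub]
  proof (intro conjI ballI impI)
    fix c assume c: "c \<in> C"
    show "\<exists>s\<in>pverts G - C. graph_dist G c s \<le> k"
    proof (cases "c = l")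
      case True
      have "graph_dist G l l' \<le> 2"
        using twins adj_commute by (intro graph_dist_common_neighbour[of l u]) auto
      moreover have "l' \<in> pverts G - C"
        using twins leaf_not_exterior by (auto simp: C_def leaf_def)
      ultimately show ?thesis using True k le_trans by blast
    next
      case False
      then obtain s where s: "s \<in> pverts G - C" "adj c s"
        using support[of c] c by (auto simp: C_def)
      then have "graph_dist G c s = 1"
        using graph_dist_eq_1_iff adj_in_verts by blast
      with s k show ?thesis by (metis le_trans one_le_numeral)
    qed
  next
    fix c c' assume c: "c \<in> C" "c' \<in> C" "c \<noteq> c'"
    then consider "exterior_major_vertex G c" | "exterior_major_vertex G c'"
      by (auto simp: C_def)
    then show "\<exists>s\<in>pverts G - C. trunc_dist G k c s \<noteq> trunc_dist G k c' s"
      by cases (use sep c in metis)+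
  qed
  from location_domination_number_le[OF sub this] show ?thesis by (simp add: card)
qed

end

end

section \<open>The equivalence for trees\<close>

theorem theorem3p12:
  fixes T :: "'a pair_pre_digraph" and n k :: nat
  assumes "undirected_tree T"
    and "card (pverts T) = n" and "n \<ge> 2"
    and "k \<ge> 1"
  shows "int (location_domination_number T k) = int n - int (num_exterior_major T) \<longleftrightarrow>
           k = 1 \<and> num_exterior_major T \<ge> 1 \<and> num_exterior_major T + num_leaves T = n"
proof -
  interpret pair_graph T
    using assms(1) by (simp add: undirected_tree_def)
  interpret connected_pair_graph T
    using assms(1) by unfold_locales (simp add: undirected_tree_def)
  have acyclic: "\<not> (\<exists>p. cycle p \<and> 3 \<le> length p)"
    using assms(1) by (simp add: undirected_tree_def)
  have n: "n = card (pverts T)" using assms(2) by simp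
  have exterior: "num_exterior_major T \<ge> 1 \<longleftrightarrow> (\<exists>m. exterior_major_vertex T m)"
    using finite_exterior by (auto simp: num_exterior_major_def Suc_le_eq card_gt_0_iff)
  have "int (location_domination_number T k) = int n - int (num_exterior_major T) \<longleftrightarrow>
      location_domination_number T k + num_exterior_major T = n" (is "_ \<longleftrightarrow> ?eq")
    by linarith
  also have "\<dots> \<longleftrightarrow> k = 1 \<and> num_exterior_major T \<ge> 1 \<and> num_exterior_major T + num_leaves T = n"
  proof
    assume eq: ?eq
    then have ex: "num_exterior_major T \<ge> 1"
      using location_domination_number_less_order[of k] assms(3,4) n by linarith
    then obtain m where m: "exterior_major_vertex T m" using exterior by blast
    \<comment> \<open>An uncovered vertex would give a complement of size \<open>ex + 1\<close> for
      distance 1, hence for \<open>k\<close> by monotonicity, and push the number below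
      \<open>n - ex\<close>.\<close>
    have cover: "exterior_major_vertex T w \<or> leaf T w" if w: "w \<in> pverts T" for w
    proof (rule ccontr)
      assume "\<not> ?thesis"
      then obtain C where C: "C \<subseteq> pverts T" "card C = Suc (num_exterior_major T)"
        "dist_locating_dominating T 1 (pverts T - C)"
        using ex_large_complement[OF m w] by blast
      from C(3) assms(4) have "dist_locating_dominating T k (pverts T - C)"
        by (rule locating_dominating_mono)
      from location_domination_number_le[OF C(1) this] C(2) eq n show False by simp
    qed
    have "\<not> k \<ge> 2"
      using location_domination_number_ge_2[OF _ cover acyclic, of k] m eq n by fastforce
    with assms(4) have "k = 1" by simp
    with ex cover show "k = 1 \<and> num_exterior_major T \<ge> 1 \<and> num_exterior_major T + num_leaves T = n"
      using exterior_leaf_cover_iff n by simp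
  next
    assume "k = 1 \<and> num_exterior_major T \<ge> 1 \<and> num_exterior_major T + num_leaves T = n"
    then show ?eq
      using location_domination_number_1 exterior exterior_leaf_cover_iff n by simp
  qed
  finally show ?thesis .
qed

end
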